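(* Let $G$ be a connected graph of order $n\geq 3$ and let $k$ be an integer with $1\le k<\Delta(G)$. Then $$\max\left\{\gamma(G),\ \left\lceil \frac{n}{k+1}\right\rceil\right\}\ \leq\ \gamma_k^{\mathrm L}(G)\ \leq\ n-k.$$
   Context: All graphs are finite, simple and undirected; $\Delta(G)$ is the maximum degree and $N(v)$ is the open neighborhood of $v$. A dominating set of $G$ is a set $D\subseteq V(G)$ such that every vertex not in $D$ has a neighbor in $D$; $\gamma(G)$ (the domination number) is the minimum cardinality of a dominating set. For an integer $0\le k\le \Delta(G)$, a set $D\subseteq V(G)$ is a $k$-limited dominating set if $D$ is a dominating set and $|N(u)-D|\le k$ for every $u\in D$. The $k$-limited domination number $\gamma_k^{\mathrm L}(G)$ is the minimum cardinality of a $k$-limited dominating set of $G$. *)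

theory Defs
  imports "Graph_Theory.Digraph_Component"
begin

text \<open>
  A finite simple undirected graph is an instance of the locale \<^locale>\<open>graph\<close>: a finite,
  loop-free digraph without parallel arcs whose adjacency relation is symmetric, so that each
  undirected edge is represented by a pair of opposite arcs.
\<close>

definition neighborhood :: "('a, 'b) pre_digraph \<Rightarrow> 'a \<Rightarrow> 'a set" where
  "neighborhood G v = {u. v \<rightarrow>\<^bsub>G\<^esub> u}"

text \<open>
  In a symmetric digraph every undirected edge at a vertex contributes exactly one outgoing arc,
  so the out-degree is the degree of the undirected graph.
\<close>

definition max_degree :: "('a, 'b) pre_digraph \<Rightarrow> nat" where
  "max_degree G = Max (out_degree G ` verts G)"

definition dominating_set :: "('a, 'b) pre_digraph \<Rightarrow> 'a set \<Rightarrow> bool" where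
  "dominating_set G D \<longleftrightarrow>
     D \<subseteq> verts G \<and> (\<forall>v \<in> verts G - D. neighborhood G v \<inter> D \<noteq> {})"

definition domination_number :: "('a, 'b) pre_digraph \<Rightarrow> nat" where
  "domination_number G = Min (card ` {D. dominating_set G D})"

definition limited_dominating_set :: "nat \<Rightarrow> ('a, 'b) pre_digraph \<Rightarrow> 'a set \<Rightarrow> bool" where
  "limited_dominating_set k G D \<longleftrightarrow>
     dominating_set G D \<and> (\<forall>u \<in> D. card (neighborhood G u - D) \<le> k)"

text \<open>
  In both minima the set ranged over is finite and nonempty for a finite graph: the full vertex
  set is dominating, and it is \<open>k\<close>-limited for every \<open>k\<close>.
\<close>

definition limited_domination_number :: "nat \<Rightarrow> ('a, 'b) pre_digraph \<Rightarrow> nat" where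
  "limited_domination_number k G = Min (card ` {D. limited_dominating_set k G D})"

end

theory Submission
  imports Defs
begin

text \<open>
  Lower bound: a minimum \<open>k\<close>-limited dominating set \<open>D\<close> is in particular dominating, so it has at
  least as many vertices as the domination number. Moreover each member of \<open>D\<close> accounts for at most
  \<open>k + 1\<close> vertices, itself and its at most \<open>k\<close> neighbors outside \<open>D\<close>, and by domination these sets
  cover the graph; so \<open>n \<le> (k + 1) |D|\<close> (\<open>limited_dominating_set_covers\<close>).

  Upper bound: it suffices to delete \<open>k\<close> vertices that all keep a neighbor among the remaining
  ones, because a vertex cannot have more than \<open>k\<close> neighbors among only \<open>k\<close> deleted vertices
  (\<open>limited_dominating_set_delete\<close>). Any \<open>k\<close> neighbors of a vertex \<open>v\<close> of maximum degree can be
  deleted: they all keep \<open>v\<close> (\<open>limited_domination_number_le_order_minus\<close>).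
\<close>

lemma (in wf_digraph) neighborhood_subset_verts: "neighborhood G v \<subseteq> verts G"
  by (auto simp: neighborhood_def)

text \<open>Without parallel arcs, an arc leaving \<open>v\<close> is determined by its head.\<close>

lemma (in digraph) out_degree_eq_card_neighborhood:
  "out_degree G v = card (neighborhood G v)"
proof -
  have "neighborhood G v = head G ` out_arcs G v"
    by (force simp: neighborhood_def arcs_ends_def arc_to_ends_def out_arcs_def)
  moreover have "inj_on (head G) (out_arcs G v)"
    by (rule inj_onI) (auto intro!: no_multi_arcs simp: arc_to_ends_def)
  ultimately show ?thesis
    by (simp add: card_image out_degree_def)
qed

lemma (in fin_digraph) finite_limited_dominating_sets:
  "finite {D. limited_dominating_set k G D}"
  by (rule finite_subset[of _ "Pow (verts G)"])
    (auto simp: limited_dominating_set_def dominating_set_def)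

lemma (in fin_digraph) limited_domination_number_le:
  assumes "limited_dominating_set k G D"
  shows "limited_domination_number k G \<le> card D"
  using assms finite_limited_dominating_sets[of k]
  by (auto simp: limited_domination_number_def intro!: Min_le)

lemma (in fin_digraph) limited_domination_number_attained:
  obtains D where "limited_dominating_set k G D" "card D = limited_domination_number k G"
proof -
  have "limited_dominating_set k G (verts G)"
    using neighborhood_subset_verts
    by (auto simp: limited_dominating_set_def dominating_set_def Diff_eq_empty_iff[THEN iffD2])
  then have "limited_domination_number k G \<in> card ` {D. limited_dominating_set k G D}"
    unfolding limited_domination_number_def
    using finite_limited_dominating_sets by (intro Min_in) auto
  with that show thesis by auto
qed

lemma (in fin_digraph) domination_number_le:
  assumes "dominating_set G D"
  shows "domination_number G \<le> card D"
proof -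
  have "finite {D. dominating_set G D}"
    by (rule finite_subset[of _ "Pow (verts G)"]) (auto simp: dominating_set_def)
  with assms show ?thesis
    by (auto simp: domination_number_def intro!: Min_le)
qed

text \<open>
  Domination is a condition on the neighbors of the dominated vertex, whereas the limit \<open>k\<close> bounds
  the neighborhoods of the dominating ones. Symmetry of the graph links the two: a vertex outside
  \<open>D\<close> lies in the neighborhood of each of its neighbors in \<open>D\<close>.
\<close>

lemma (in graph) limited_dominating_set_covers:
  assumes D: "limited_dominating_set k G D"
  shows "card (verts G) \<le> card D * (k + 1)"
proof -
  let ?C = "\<lambda>u. insert u (neighborhood G u - D)"
  have "D \<subseteq> verts G"
    using D by (simp add: limited_dominating_set_def dominating_set_def)
  then have fin: "finite D"
    by (rule finite_subset) simp
  have fin_C: "finite (?C u)" for u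
    using finite_subset[OF neighborhood_subset_verts] by simp
  have "verts G \<subseteq> (\<Union>u\<in>D. ?C u)"
  proof
    fix v assume v: "v \<in> verts G"
    show "v \<in> (\<Union>u\<in>D. ?C u)"
    proof (cases "v \<in> D")
      case False
      then obtain u where "u \<in> D" "v \<rightarrow>\<^bsub>G\<^esub> u"
        using D v unfolding limited_dominating_set_def dominating_set_def neighborhood_def by blast
      then have "u \<in> D" "u \<rightarrow>\<^bsub>G\<^esub> v"
        by (auto intro: graph_symmetric)
      with False show ?thesis
        by (auto simp: neighborhood_def)
    qed auto
  qed
  then have "card (verts G) \<le> card (\<Union>u\<in>D. ?C u)"
    by (intro card_mono finite_UN_I fin fin_C)
  also have "\<dots> \<le> (\<Sum>u\<in>D. card (?C u))"
    by (rule card_UN_le[OF fin])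
  also have "\<dots> \<le> (\<Sum>u\<in>D. k + 1)"
  proof (rule sum_mono)
    fix u assume "u \<in> D"
    then have "card (neighborhood G u - D) \<le> k"
      using D by (simp add: limited_dominating_set_def)
    moreover have "card (?C u) \<le> Suc (card (neighborhood G u - D))"
      by (rule card_insert_le_m1) auto
    ultimately show "card (?C u) \<le> k + 1"
      by simp
  qed
  finally show ?thesis by simp
qed

lemma (in fin_digraph) limited_dominating_set_delete:
  assumes S: "S \<subseteq> verts G" "card S \<le> k"
    and keeps: "\<And>v. v \<in> S \<Longrightarrow> \<not> neighborhood G v \<subseteq> S"
  shows "limited_dominating_set k G (verts G - S)"
  unfolding limited_dominating_set_def dominating_set_def
proof (intro conjI ballI)
  fix v assume "v \<in> verts G - (verts G - S)"
  then show "neighborhood G v \<inter> (verts G - S) \<noteq> {}"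
    using keeps neighborhood_subset_verts by blast
next
  fix u
  have "card (neighborhood G u - (verts G - S)) \<le> card S"
    using S(1) neighborhood_subset_verts finite_subset[OF S(1)] by (intro card_mono) auto
  with S(2) show "card (neighborhood G u - (verts G - S)) \<le> k"
    by simp
qed auto

lemma (in graph) limited_domination_number_le_order_minus:
  assumes v: "k \<le> card (neighborhood G v)"
  shows "limited_domination_number k G \<le> card (verts G) - k"
proof -
  obtain S where S: "S \<subseteq> neighborhood G v" "card S = k"
    using obtain_subset_with_card_n[OF v] by blast
  have "v \<notin> S"
    using S(1) by (auto simp: neighborhood_def dest: adj_not_same)
  moreover have "v \<in> neighborhood G u" if "u \<in> S" for u
    using that S(1) by (auto simp: neighborhood_def intro: graph_symmetric)
  ultimately have "\<not> neighborhood G u \<subseteq> S" if "u \<in> S" for u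
    using that by blast
  moreover have "S \<subseteq> verts G"
    using S(1) neighborhood_subset_verts by blast
  ultimately show ?thesis
    using limited_domination_number_le[OF limited_dominating_set_delete, of S k] S(2)
    by (simp add: card_Diff_subset finite_subset)
qed

theorem theorem3:
  fixes G :: "('a, 'b) pre_digraph" and n k :: nat
  assumes "graph G"
    and "Digraph_Component.connected G"
    and "card (verts G) = n"
    and "n \<ge> 3"
    and "1 \<le> k"
    and "k < max_degree G"
  shows "max (int (domination_number G)) \<lceil>real n / real (k + 1)\<rceil>
           \<le> int (limited_domination_number k G)
         \<and> int (limited_domination_number k G) \<le> int n - int k"
proof -
  interpret graph G by fact
  obtain D where D: "limited_dominating_set k G D" "card D = limited_domination_number k G"
    by (rule limited_domination_number_attained)
  have "domination_number G \<le> limited_domination_number k G"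
    using D domination_number_le by (metis limited_dominating_set_def)
  moreover have "\<lceil>real n / real (k + 1)\<rceil> \<le> int (limited_domination_number k G)"
  proof -
    have "n \<le> limited_domination_number k G * (k + 1)"
      using limited_dominating_set_covers[OF D(1)] D(2) assms(3) by simp
    then have "real n \<le> real (limited_domination_number k G) * real (k + 1)"
      by (metis of_nat_le_iff of_nat_mult)
    then show ?thesis
      by (simp add: ceiling_le_iff divide_le_eq)
  qed
  moreover have "int (limited_domination_number k G) \<le> int n - int k"
  proof -
    have "max_degree G \<in> out_degree G ` verts G"
      unfolding max_degree_def using assms(3,4) by (intro Max_in) auto
    then obtain v where "max_degree G = card (neighborhood G v)"
      by (auto simp: out_degree_eq_card_neighborhood)
    then have deg: "k \<le> card (neighborhood G v)"
      using assms(6) by simp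
    have "card (neighborhood G v) \<le> n"
      using assms(3) card_mono[OF finite_verts neighborhood_subset_verts] by blast
    with deg show ?thesis
      using limited_domination_number_le_order_minus[OF deg] assms(3) by linarith
  qed
  ultimately show ?thesis by simp
qed

end
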